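(* For any sequence of positive reals $\eta_N$ decreasing to $0$ as $N \to \infty$, there exists a real polynomial $f$ with at least one irrational non-constant coefficient such that the following holds: for $n$ chosen uniformly at random from $[N]=\{1,\dots,N\}$, the Kolmogorov distance between the random variable \[ \frac{\omega(\lfloor f(n)\rfloor) - \log\log N}{\sqrt{\log\log N}} \] and the standard Gaussian $\mathcal{N}(0,1)$ is not $O(\eta_N)$ as $N \to \infty$.
   Context: $\omega(m)$ denotes the number of distinct prime divisors of an integer $m$. For real random variables $X, Y$, the Kolmogorov distance is $d_K(X,Y) = \sup_{x \in \mathbb{R}} |\mathbb{P}(X \le x) - \mathbb{P}(Y \le x)|$. *)

theory Defs
  imports "HOL-Probability.Probability" "HOL-Computational_Algebra.Computational_Algebra"
begin

text \<open>Since \<open>prime_factors 0 = {}\<close>, this sets \<open>omega 0 = 0\<close>; also \<open>omega (- m) = omega m\<close>.\<close>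

definition omega :: "int \<Rightarrow> nat" where
  "omega m = card (prime_factors m)"

definition kolmogorov_dist ::
    "'a measure \<Rightarrow> ('a \<Rightarrow> real) \<Rightarrow> 'b measure \<Rightarrow> ('b \<Rightarrow> real) \<Rightarrow> real" where
  "kolmogorov_dist M X M' Y =
     (SUP x::real. \<bar>\<P>(u in M. X u \<le> x) - \<P>(v in M'. Y v \<le> x)\<bar>)"

end

theory Submission
  imports Defs
begin

text \<open>
  Suppose the conclusion fails and let \<open>\<alpha>\<close> be irrational. Then the distances for the three
  polynomials \<open>\<alpha>x\<close>, \<open>\<alpha>x + 1\<close> and \<open>\<alpha>x(\<alpha>x + 1)\<close> are all \<open>O(\<eta>)\<close>, so
  that, outside a proportion of \<open>n \<le> N\<close> tending to zero at a rate depending only on \<open>\<eta>\<close>,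
  each of the three values of \<open>omega\<close> is within a quarter of \<open>L = log log N\<close> from \<open>L\<close>.
  By Baire's theorem \<open>\<alpha>\<close> may be chosen so well approximable from below by fractions \<open>a/q\<close> that,
  for infinitely many \<open>N\<close>, the multiples \<open>n \<le> N\<close> of \<open>q\<close> are not all exceptional, while for them
  the three integer parts are \<open>t\<close>, \<open>t + 1\<close> and \<open>t(t + 1)\<close>, where \<open>t = an/q\<close>. Since \<open>t\<close> and
  \<open>t + 1\<close> are coprime, the third value of \<open>omega\<close> is the sum of the first two, which is absurd.
\<close>

section \<open>Prime divisors of products of consecutive integers\<close>

lemma omega_mult_coprime:
  assumes "coprime a b" "a \<noteq> 0" "b \<noteq> 0"
  shows "omega (a * b) = omega a + omega b"
proof -
  have "prime_factors a \<inter> prime_factors b = {}"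
    using assms(1) by (auto simp: prime_factors_dvd dest: coprime_common_divisor not_prime_unit)
  then show ?thesis
    using assms by (simp add: omega_def prime_factors_product card_Un_disjoint)
qed

text \<open>Consecutive integers are coprime. At t = 0 and t = -1, where the product vanishes, both
  sides are 0 because \<open>omega\<close> is 0 at 0 and at units.\<close>

lemma omega_consecutive: "omega (t * (t + 1)) = omega t + omega (t + 1)"
proof (cases "t = 0 \<or> t + 1 = 0")
  case True
  then have "t = 0 \<or> t = - 1" by linarith
  moreover have "prime_factors (- 1 :: int) = {}"
    by (simp add: prime_factorization_unit)
  ultimately show ?thesis by (auto simp: omega_def)
next
  case False
  then show ?thesis by (intro omega_mult_coprime) auto
qed

section \<open>From Kolmogorov distance to counts of exceptional integers\<close>

lemma kolmogorov_dist_upper: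
  assumes "prob_space M" "prob_space M'"
  shows "\<bar>\<P>(u in M. X u \<le> x) - \<P>(v in M'. Y v \<le> x)\<bar> \<le> kolmogorov_dist M X M' Y"
  unfolding kolmogorov_dist_def
proof (rule cSUP_upper)
  \<comment> \<open>A real \<open>SUP\<close> dominates its terms only for a bounded family; here 1
    is a bound, as probabilities lie in [0, 1].\<close>
  show "bdd_above (range (\<lambda>x. \<bar>\<P>(u in M. X u \<le> x) - \<P>(v in M'. Y v \<le> x)\<bar>))"
  proof (rule bdd_aboveI2)
    fix x
    have "0 \<le> \<P>(u in M. X u \<le> x)" "0 \<le> \<P>(v in M'. Y v \<le> x)"
      "\<P>(u in M. X u \<le> x) \<le> 1" "\<P>(v in M'. Y v \<le> x) \<le> 1"
      using assms by (auto intro: prob_space.prob_le_1)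
    then show "\<bar>\<P>(u in M. X u \<le> x) - \<P>(v in M'. Y v \<le> x)\<bar> \<le> 1"
      by linarith
  qed
qed simp

abbreviation (input) gauss_cdf :: "real \<Rightarrow> real" where
  "gauss_cdf \<equiv> cdf std_normal_distribution"

abbreviation (input) normalised_dist :: "(nat \<Rightarrow> real) \<Rightarrow> nat \<Rightarrow> real \<Rightarrow> real" where
  "normalised_dist W N L \<equiv> kolmogorov_dist (measure_pmf (pmf_of_set {1..N}))
     (\<lambda>n. (W n - L) / sqrt L) std_normal_distribution (\<lambda>y. y)"

lemma normalised_dist_upper:
  assumes "N \<ge> 1"
  shows "\<bar>card {n \<in> {1..N}. (W n - L) / sqrt L \<le> x} / N - gauss_cdf x\<bar> \<le> normalised_dist W N L"
proof -
  have "\<P>(n in measure_pmf (pmf_of_set {1..N}). (W n - L) / sqrt L \<le> x) =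
      card {n \<in> {1..N}. (W n - L) / sqrt L \<le> x} / N"
    using assms by (simp add: measure_pmf_of_set Int_def)
  moreover have "\<P>(y in std_normal_distribution. y \<le> x) = gauss_cdf x"
    by (simp add: cdf_def atMost_def)
  ultimately show ?thesis
    using kolmogorov_dist_upper[of "measure_pmf (pmf_of_set {1..N})" std_normal_distribution
        "\<lambda>n. (W n - L) / sqrt L" x "\<lambda>y. y"]
    by (simp add: prob_space_normal_density measure_pmf.prob_space_axioms)
qed

text \<open>The threshold 3/4 L is the point - sqrt L / 4 after normalisation. With 5/4 L as upper
  threshold, two values above 3/4 L already sum to too much.\<close>

lemma card_low_values_le:
  assumes "N \<ge> 1" "L > 0"
  shows "card {n \<in> {1..N}. W n \<le> 3 / 4 * L} \<le> N * (normalised_dist W N L + gauss_cdf (- sqrt L / 4))"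
proof -
  have "(W n - L) / sqrt L \<le> - sqrt L / 4 \<longleftrightarrow> W n \<le> 3 / 4 * L" for n
    using assms by (simp add: field_simps)
  then have "card {n \<in> {1..N}. W n \<le> 3 / 4 * L} / N \<le> normalised_dist W N L + gauss_cdf (- sqrt L / 4)"
    using normalised_dist_upper[OF assms(1), of W L "- sqrt L / 4"] by simp
  then show ?thesis
    using assms by (simp add: field_simps)
qed

lemma card_high_values_le:
  assumes "N \<ge> 1" "L > 0"
  shows "card {n \<in> {1..N}. W n > 5 / 4 * L} \<le> N * (normalised_dist W N L + (1 - gauss_cdf (sqrt L / 4)))"
proof -
  let ?low = "{n \<in> {1..N}. W n \<le> 5 / 4 * L}" and ?high = "{n \<in> {1..N}. W n > 5 / 4 * L}"
  have "(W n - L) / sqrt L \<le> sqrt L / 4 \<longleftrightarrow> W n \<le> 5 / 4 * L" for n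
    using assms by (simp add: field_simps)
  then have "gauss_cdf (sqrt L / 4) - card ?low / N \<le> normalised_dist W N L"
    using normalised_dist_upper[OF assms(1), of W L "sqrt L / 4"] by simp
  moreover have "card (?low \<union> ?high) = card ?low + card ?high"
    by (rule card_Un_disjoint) auto
  moreover have "?low \<union> ?high = {1..N}" by auto
  ultimately show ?thesis
    using assms by (simp add: field_simps)
qed

abbreviation (input) loglog :: "nat \<Rightarrow> real" where
  "loglog N \<equiv> ln (ln (real N))"

text \<open>Gaussian mass of the three exceptional events: a lower tail for each of the two linear
  polynomials and an upper tail for their product.\<close>

abbreviation (input) tail :: "nat \<Rightarrow> real" where
  "tail N \<equiv> 2 * gauss_cdf (- sqrt (loglog N) / 4) + (1 - gauss_cdf (sqrt (loglog N) / 4))"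

lemma filterlim_loglog: "filterlim loglog at_top sequentially"
  by (intro filterlim_compose[OF ln_at_top] filterlim_real_sequentially)

lemma tail_tendsto_0: "tail \<longlonglongrightarrow> 0"
proof -
  interpret real_distribution std_normal_distribution
    by (rule real_dist_normal_dist)
  have top: "filterlim (\<lambda>N. sqrt (loglog N) / 4) at_top sequentially"
    using filterlim_tendsto_pos_mult_at_top[OF tendsto_const[of "1/4"] _
        filterlim_compose[OF sqrt_at_top filterlim_loglog]] by simp
  then have bot: "filterlim (\<lambda>N. - sqrt (loglog N) / 4) at_bot sequentially"
    by (simp add: filterlim_uminus_at_top)
  have "tail \<longlonglongrightarrow> 2 * 0 + (1 - 1)"
    by (intro tendsto_intros filterlim_compose[OF cdf_lim_at_bot bot]
        filterlim_compose[OF cdf_lim_at_top_prob top])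
  then show ?thesis by simp
qed

section \<open>Diophantine approximation by a Baire category argument\<close>

text \<open>The conclusion is one-sided (\<open>a / q < \<alpha>\<close>) so that integer parts are not affected.\<close>

lemma exists_well_approximable_irrational:
  fixes \<theta> :: "nat \<Rightarrow> real" and \<delta> :: "nat \<Rightarrow> real"
  assumes \<theta>: "\<theta> \<longlonglongrightarrow> 0" and \<delta>: "\<And>N. N \<ge> 1 \<Longrightarrow> \<delta> N > 0"
  obtains \<alpha> where "0 < \<alpha>" "\<alpha> < 1" "\<alpha> \<notin> \<rat>"
    "\<And>M. \<exists>N\<ge>M. \<exists>(q::nat) (a::int). 1 \<le> q \<and> q \<le> N \<and> 2 * q * \<theta> N < 1 \<and>
         a / q < \<alpha> \<and> \<alpha> < a / q + \<delta> N"
proof -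
  define P where "P M N q \<longleftrightarrow> M \<le> N \<and> 1 \<le> q \<and> q \<le> N \<and> 2 * real q * \<theta> N < 1" for M N q :: nat
  define U where "U M = (\<Union>N. \<Union>q \<in> {q. P M N q}. \<Union>a::int. {a / q <..< a / q + \<delta> N})" for M
  \<comment> \<open>The complements of single rationals force irrationality and keep the family
    countable.\<close>
  define G where "G = range U \<union> (\<lambda>r. - {r}) ` (\<rat> :: real set)"
  have open_U: "open (U M)" for M
    unfolding U_def by (intro open_UN ballI open_greaterThanLessThan)
  have dense_U: "closure (U M) = UNIV" for M
  proof -
    \<comment> \<open>For r = a/q the denominator is fixed first; then N is taken so large that
      \<theta> N < 1/(2q), which makes r the left endpoint of an interval inside
      \<open>U M\<close>.\<close>
    have "\<rat> \<subseteq> closure (U M)"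
    proof
      fix r :: real
      assume "r \<in> \<rat>"
      then obtain a :: int and b :: int where ab: "b > 0" "r = a / b"
        by (elim Rats_cases') auto
      define q where "q = nat b"
      have q: "q \<ge> 1" "r = a / q"
        using ab by (auto simp: q_def)
      have "\<forall>\<^sub>F N in sequentially. \<theta> N < 1 / (2 * q)"
        using q by (intro order_tendstoD(2)[OF \<theta>]) simp
      then have "\<forall>\<^sub>F N in sequentially. \<theta> N < 1 / (2 * q) \<and> N \<ge> M \<and> N \<ge> q"
        by (intro eventually_conj eventually_ge_at_top)
      then obtain N where N: "\<theta> N < 1 / (2 * q)" "N \<ge> M" "N \<ge> q"
        using eventually_happens'[OF sequentially_bot] by blast
      then have "P M N q"
        using q by (simp add: P_def field_simps)
      then have "{r<..<r + \<delta> N} \<subseteq> U M"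
        unfolding U_def q(2) by blast
      then have "closure {r<..<r + \<delta> N} \<subseteq> closure (U M)"
        by (rule closure_mono)
      moreover have "\<delta> N > 0"
        using \<delta> N q by simp
      ultimately show "r \<in> closure (U M)"
        by (auto simp: closure_greaterThanLessThan)
    qed
    then have "closure \<rat> \<subseteq> closure (U M)"
      by (simp add: closure_minimal)
    then show ?thesis
      by (simp add: Rats_closure_real top.extremum_unique)
  qed
  have "(UNIV :: real set) \<subseteq> closure (\<Inter>G)"
  proof (rule Baire)
    show "countable G"
      by (auto simp: G_def countable_rat)
    fix T
    assume "T \<in> G"
    then have "open T \<and> closure T = UNIV"
      using dense_U open_U by (auto simp: G_def closure_complement)
    then show "openin (top_of_set UNIV) T \<and> UNIV \<subseteq> closure T"
      by simp
  qed simp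
  then have "(1/2 :: real) \<in> closure (\<Inter>G)"
    by blast
  then obtain \<alpha> where "\<alpha> \<in> \<Inter>G" and "dist \<alpha> (1/2) < 1/2"
    unfolding closure_approachable by (auto dest: spec[of _ "1/2"])
  then have \<alpha>: "\<And>M. \<alpha> \<in> U M" "\<alpha> \<notin> \<rat>" "0 < \<alpha>" "\<alpha> < 1"
    by (auto simp: G_def dist_real_def)
  show thesis
  proof (rule that[OF \<alpha>(3,4,2)])
    fix M
    show "\<exists>N\<ge>M. \<exists>(q::nat) (a::int). 1 \<le> q \<and> q \<le> N \<and> 2 * q * \<theta> N < 1 \<and>
         a / q < \<alpha> \<and> \<alpha> < a / q + \<delta> N"
      using \<alpha>(1)[of M] unfolding U_def P_def by auto
  qed
qed

section \<open>Integer parts and multiples of q\<close>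

text \<open>In the quadratic value the error e = \<alpha> n - t is multiplied by \<alpha> n + t + 1
  \<le> 3N, so e < 1/(4N) keeps the total error below 3/4. Positivity of e stops the floors from
  dropping.\<close>

lemma floor_values:
  fixes \<alpha> :: real and t :: int and n N :: nat
  assumes "0 < \<alpha>" "\<alpha> < 1" "n \<le> N" "N \<ge> 1"
    and "t < \<alpha> * n" "\<alpha> * n < t + 1 / (4 * real N)"
  shows "\<lfloor>\<alpha> * n\<rfloor> = t" "\<lfloor>\<alpha> * n + 1\<rfloor> = t + 1" "\<lfloor>\<alpha> * n * (\<alpha> * n + 1)\<rfloor> = t * (t + 1)"
proof -
  define e where "e = \<alpha> * n - t"
  have "1 / (4 * real N) \<le> 1 / 4"
    using assms by (simp add: field_simps)
  then have e: "0 < e" "e < 1 / (4 * real N)" "e < 1/4"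
    using assms unfolding e_def by linarith+
  show t: "\<lfloor>\<alpha> * n\<rfloor> = t" "\<lfloor>\<alpha> * n + 1\<rfloor> = t + 1"
    using e unfolding e_def by linarith+
  have "0 \<le> \<alpha> * n" using assms by simp
  then have "t \<ge> 0" using t(1) by (metis zero_le_floor)
  have "\<alpha> * n \<le> 1 * real N"
    using assms by (intro mult_mono) auto
  then have "\<alpha> * n + t + 1 \<le> 3 * real N"
    using assms by linarith
  then have "e * (\<alpha> * n + t + 1) \<le> 1 / (4 * real N) * (3 * real N)"
    using e \<open>t \<ge> 0\<close> \<open>0 \<le> \<alpha> * n\<close> by (intro mult_mono) auto
  also have "\<dots> < 1" using assms by simp
  finally have "e * (\<alpha> * n + t + 1) < 1" .
  moreover have "0 \<le> e * (\<alpha> * n + t + 1)"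
    using e \<open>t \<ge> 0\<close> \<open>0 \<le> \<alpha> * n\<close> by simp
  moreover have "\<alpha> * n * (\<alpha> * n + 1) = of_int (t * (t + 1)) + e * (\<alpha> * n + t + 1)"
    by (simp add: e_def algebra_simps)
  ultimately show "\<lfloor>\<alpha> * n * (\<alpha> * n + 1)\<rfloor> = t * (t + 1)"
    by (simp only: floor_eq_iff) linarith
qed

text \<open>As q \<le> N, the quotient \<open>N div q\<close> is at least 1, so the remainder is
  less than q \<le> q * (N div q).\<close>

lemma card_multiples:
  assumes "1 \<le> q" "q \<le> N"
  shows "real N < 2 * q * card {n \<in> {1..N}. q dvd n}"
proof -
  have "(\<lambda>m. q * m) ` {1..N div q} \<subseteq> {n \<in> {1..N}. q dvd n}"
    using assms by (auto simp: less_eq_div_iff_mult_less_eq mult.commute)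
  moreover have "card ((\<lambda>m. q * m) ` {1..N div q}) = N div q"
    using assms by (simp add: card_image inj_on_def)
  ultimately have "N div q \<le> card {n \<in> {1..N}. q dvd n}"
    using card_mono[of "{n \<in> {1..N}. q dvd n}" "(\<lambda>m. q * m) ` {1..N div q}"] by simp
  moreover have "N < 2 * q * (N div q)"
  proof -
    have "N = q * (N div q) + N mod q" by simp
    moreover have "N mod q < q" using assms by simp
    moreover have "q * 1 \<le> q * (N div q)"
      using assms by (intro mult_left_mono) (simp_all add: less_eq_div_iff_mult_less_eq)
    ultimately show ?thesis by linarith
  qed
  ultimately have "N < 2 * q * card {n \<in> {1..N}. q dvd n}"
    by (meson less_le_trans mult_le_mono2)
  then show ?thesis
    by (metis of_nat_less_iff of_nat_mult of_nat_numeral)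
qed

theorem theorem1p8:
  fixes \<eta> :: "nat \<Rightarrow> real"
  assumes "\<And>N. \<eta> N > 0"
    and "decseq \<eta>"
    and "\<eta> \<longlonglongrightarrow> 0"
  shows "\<exists>f :: real poly.
    (\<exists>i\<ge>1. coeff f i \<notin> \<rat>) \<and>
    (\<lambda>N. kolmogorov_dist
            (measure_pmf (pmf_of_set {1..N}))
            (\<lambda>n. (real (omega \<lfloor>poly f (real n)\<rfloor>) - ln (ln (real N))) / sqrt (ln (ln (real N))))
            std_normal_distribution (\<lambda>y. y))
      \<notin> O(\<eta>)"
proof (rule ccontr)
  assume contra: "\<not> ?thesis"
  \<comment> \<open>The constants hidden in O(\<eta>) depend on \<alpha>, but \<theta> must be fixed
    before \<alpha>. The square root solves this: it eventually exceeds any constant multiple of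
    \<eta>.\<close>
  define \<theta> where "\<theta> N = sqrt (\<eta> N) + tail N" for N
  have "\<theta> \<longlonglongrightarrow> sqrt 0 + 0"
    unfolding \<theta>_def by (intro tendsto_add tendsto_real_sqrt assms(3) tail_tendsto_0)
  then have \<theta>: "\<theta> \<longlonglongrightarrow> 0" by simp
  obtain \<alpha> where \<alpha>: "0 < \<alpha>" "\<alpha> < 1" "\<alpha> \<notin> \<rat>"
    and approx: "\<And>M. \<exists>N\<ge>M. \<exists>(q::nat) (a::int). 1 \<le> q \<and> q \<le> N \<and> 2 * q * \<theta> N < 1 \<and>
         a / q < \<alpha> \<and> \<alpha> < a / q + 1 / (4 * real N * real N)"
    by (rule exists_well_approximable_irrational[OF \<theta>, of "\<lambda>N. 1 / (4 * real N * real N)"]) auto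

  define W where "W f n = real (omega \<lfloor>poly f (real n)\<rfloor>)" for f :: "real poly" and n :: nat
  \<comment> \<open>Here f3 = f1 * f2, and all three have the irrational linear coefficient
    \<alpha>, so the negated claim applies to each with i = 1, even if \<alpha> squared is
    rational.\<close>
  define f1 f2 f3 where "f1 = [:0, \<alpha>:]" and "f2 = [:1, \<alpha>:]" and "f3 = [:0, \<alpha>, \<alpha>\<^sup>2:]"
  define D where "D f N = normalised_dist (W f) N (loglog N)" for f N
  have bound: "\<exists>C. \<forall>\<^sub>F N in sequentially. D f N \<le> C * \<eta> N" if "coeff f 1 = \<alpha>" for f
  proof -
    have "D f \<in> O(\<eta>)"
    proof (rule ccontr)
      assume "D f \<notin> O(\<eta>)"
      moreover have "\<exists>i\<ge>1. coeff f i \<notin> \<rat>"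
        using that \<alpha>(3) by (intro exI[of _ 1]) simp
      ultimately show False
        using contra unfolding D_def W_def by blast
    qed
    then obtain C where "\<forall>\<^sub>F N in sequentially. norm (D f N) \<le> C * norm (\<eta> N)"
      by (elim landau_o.bigE)
    then have "\<forall>\<^sub>F N in sequentially. D f N \<le> C * \<eta> N"
      by eventually_elim (use assms(1) in \<open>simp add: abs_of_pos\<close>)
    then show ?thesis by blast
  qed
  obtain C1 C2 C3 where C: "\<forall>\<^sub>F N in sequentially. D f1 N \<le> C1 * \<eta> N"
    "\<forall>\<^sub>F N in sequentially. D f2 N \<le> C2 * \<eta> N" "\<forall>\<^sub>F N in sequentially. D f3 N \<le> C3 * \<eta> N"
    using bound[of f1] bound[of f2] bound[of f3] by (auto simp: f1_def f2_def f3_def)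
  have "(\<lambda>N. (C1 + C2 + C3) * sqrt (\<eta> N)) \<longlonglongrightarrow> (C1 + C2 + C3) * sqrt 0"
    by (intro tendsto_intros assms(3))
  then have "\<forall>\<^sub>F N in sequentially. (C1 + C2 + C3) * sqrt (\<eta> N) < 1"
    by (rule order_tendstoD(2)) simp
  moreover have "\<forall>\<^sub>F N in sequentially. loglog N > 0"
    using filterlim_loglog by (simp add: filterlim_at_top_dense)
  ultimately have "\<forall>\<^sub>F N in sequentially. loglog N > 0 \<and> D f1 N + D f2 N + D f3 N < sqrt (\<eta> N)"
    using C
  proof eventually_elim
    case (elim N)
    have "(C1 + C2 + C3) * sqrt (\<eta> N) * sqrt (\<eta> N) < 1 * sqrt (\<eta> N)"
      using elim assms(1) by (intro mult_strict_right_mono) auto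
    moreover have "sqrt (\<eta> N) * sqrt (\<eta> N) = \<eta> N"
      using assms(1)[of N] by simp
    ultimately have "(C1 + C2 + C3) * \<eta> N < sqrt (\<eta> N)"
      by (simp add: mult.assoc)
    with elim show ?case by (simp add: algebra_simps)
  qed
  then obtain M where M: "\<And>N. N \<ge> M \<Longrightarrow> loglog N > 0 \<and> D f1 N + D f2 N + D f3 N < sqrt (\<eta> N)"
    by (auto simp: eventually_sequentially)

  obtain N q :: nat and a :: int where "N \<ge> M" and q: "1 \<le> q" "q \<le> N" "2 * q * \<theta> N < 1"
    and a: "a / q < \<alpha>" "\<alpha> < a / q + 1 / (4 * real N * real N)"
    using approx[of M] by blast
  define L where "L = loglog N"
  have N: "N \<ge> 1" "L > 0" "D f1 N + D f2 N + D f3 N < sqrt (\<eta> N)"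
    using M[OF \<open>N \<ge> M\<close>] q by (auto simp: L_def)
  define B1 where "B1 = {n \<in> {1..N}. W f1 n \<le> 3 / 4 * L}"
  define B2 where "B2 = {n \<in> {1..N}. W f2 n \<le> 3 / 4 * L}"
  define B3 where "B3 = {n \<in> {1..N}. W f3 n > 5 / 4 * L}"
  have "card B1 \<le> N * (D f1 N + gauss_cdf (- sqrt L / 4))"
    "card B2 \<le> N * (D f2 N + gauss_cdf (- sqrt L / 4))"
    "card B3 \<le> N * (D f3 N + (1 - gauss_cdf (sqrt L / 4)))"
    unfolding B1_def B2_def B3_def D_def L_def[symmetric]
    by (intro card_low_values_le card_high_values_le N)+
  then have "real (card B1 + card B2 + card B3) \<le> N * (D f1 N + D f2 N + D f3 N + tail N)"
    unfolding L_def by (simp add: algebra_simps)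
  also have "\<dots> \<le> N * \<theta> N"
    using N unfolding \<theta>_def by (intro mult_left_mono) auto
  finally have "real (card (B1 \<union> B2 \<union> B3)) \<le> N * \<theta> N"
    using card_Un_le[of "B1 \<union> B2" B3] card_Un_le[of B1 B2] by linarith
  \<comment> \<open>By the choice of q, the exceptional set is smaller than the set of multiples of
    q, however sparse these are.\<close>
  then have "2 * q * real (card (B1 \<union> B2 \<union> B3)) \<le> 2 * q * (N * \<theta> N)"
    by (intro mult_left_mono) auto
  also have "\<dots> = N * (2 * q * \<theta> N)" by simp
  also have "\<dots> \<le> real N * 1"
    using q by (intro mult_left_mono) auto
  also have "\<dots> < 2 * q * card {n \<in> {1..N}. q dvd n}"
    using card_multiples[OF q(1,2)] by simp
  finally have "card (B1 \<union> B2 \<union> B3) < card {n \<in> {1..N}. q dvd n}"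
    using q by simp
  moreover have "finite (B1 \<union> B2 \<union> B3)"
    by (simp add: B1_def B2_def B3_def)
  ultimately have "\<not> {n \<in> {1..N}. q dvd n} \<subseteq> B1 \<union> B2 \<union> B3"
    by (meson card_mono not_le)
  then obtain n where n: "n \<in> {1..N}" "q dvd n" "n \<notin> B1" "n \<notin> B2" "n \<notin> B3"
    by blast
  then obtain m where m: "n = q * m" by blast
  \<comment> \<open>This is the integer a n / q. The gap to \<alpha> n is n times that between a/q
    and \<alpha>, hence the approximation to within 1/(4 N N).\<close>
  define t where "t = a * int m"
  have t: "of_int t = a / q * n"
    using q by (simp add: t_def m)
  have "of_int t < \<alpha> * n"
    using a n unfolding t by (intro mult_strict_right_mono) auto
  moreover have "\<alpha> * n < of_int t + 1 / (4 * real N)"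
  proof -
    have "\<alpha> * n < (a / q + 1 / (4 * real N * real N)) * n"
      using a n by (intro mult_strict_right_mono) auto
    also have "\<dots> = of_int t + 1 / (4 * real N * real N) * n"
      unfolding t by (simp add: algebra_simps)
    also have "1 / (4 * real N * real N) * n \<le> 1 / (4 * real N * real N) * N"
      using n by (intro mult_left_mono) auto
    also have "\<dots> = 1 / (4 * real N)"
      using N by simp
    finally show ?thesis by simp
  qed
  ultimately have "\<lfloor>\<alpha> * n\<rfloor> = t" "\<lfloor>\<alpha> * n + 1\<rfloor> = t + 1" "\<lfloor>\<alpha> * n * (\<alpha> * n + 1)\<rfloor> = t * (t + 1)"
    using \<alpha> n N by (intro floor_values[of \<alpha> n N t]; simp)+
  moreover have "poly f1 n = \<alpha> * n" "poly f2 n = \<alpha> * n + 1" "poly f3 n = \<alpha> * n * (\<alpha> * n + 1)"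
    by (simp_all add: f1_def f2_def f3_def power2_eq_square algebra_simps)
  ultimately have "W f3 n = W f1 n + W f2 n"
    by (simp add: W_def omega_consecutive)
  \<comment> \<open>The sum would exceed 3/2 L while being at most 5/4 L.\<close>
  moreover have "W f1 n > 3 / 4 * L" "W f2 n > 3 / 4 * L" "W f3 n \<le> 5 / 4 * L"
    using n by (auto simp: B1_def B2_def B3_def)
  ultimately show False
    using N(2) by linarith
qed

end
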